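(* Consider the problem $$(P_0):\ \min_{(X,Y)\in\Omega^1\times\Omega^2}F_0(X,Y):=f(XY^{\mathbb T})+\lambda\big(\mathrm{nnzc}(X)+\mathrm{nnzc}(Y)\big),$$ and let $\mathcal G_0$, $\mathcal L_0$, $\mathcal S_0$ be its sets of global minimizers, local minimizers and stationary points. Then: (i) For any $(X,Y)\in\mathcal G_0$, $(X,Y)$ has the column consistency property, i.e. $\mathcal I_X=\mathcal I_Y$. (ii) For any $(X,Y)\in\Omega^1\times\Omega^2$, with $\mathcal I=\mathcal I_X\cap\mathcal I_Y$, one has $(X,Y)\in\mathcal L_0$ if and only if $(X_{\mathcal I},Y_{\mathcal I})$ is a local solution of $$\min_{M,N}\ f(MN^{\mathbb T})\quad\text{s.t.}\quad(M,N)\in\Omega_{X,Y}:=\{(M,N):M\in\Omega^1_{\mathcal I},\,N\in\Omega^2_{\mathcal I}\}.$$ Moreover, $(X,Y)\in\mathcal L_0$ if $XY^{\mathbb T}$ is a local solution of $\min_Z f(Z)$ s.t. $Z\in\{MN^{\mathbb T}:(M,N)\in\Omega_{X,Y}\}$. (iii) $\mathcal L_0\subseteq\mathcal S_0$. Moreover, if $(X,Y)\in\mathcal L_0$ (or $\mathcal S_0$), then $(X^s,Y^s)$ defined by $X^s_{\mathcal I}=X_{\mathcal I}$, $X^s_{\mathcal I^c}=0$, $Y^s_{\mathcal I}=Y_{\mathcal I}$, $Y^s_{\mathcal I^c}=0$ with $\mathcal I=\mathcal I_X\cap\mathcal I_Y$ satisfies $(X^s,Y^s)\in\mathcal L_0$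 (or $\mathcal S_0$, respectively) and $F_0(X^s,Y^s)\le F_0(X,Y)$. (iv) If $(X,Y)\in\mathcal G_0$ (or $\mathcal L_0$), then $(\gamma X,\frac1\gamma Y)\in\mathcal G_0$ (or $\mathcal L_0$, respectively) for any $\gamma\ne0$ satisfying $(\gamma X,\frac1\gamma Y)\in\Omega^1\times\Omega^2$.
   Context: Let $m\ge n\ge1$ and $d\ge1$ be integers, $\lambda>0$, $\varsigma>0$, and let $f:\mathbb R^{m\times n}\to\mathbb R$ be locally Lipschitz continuous. $[d]=\{1,\dots,d\}$; $\|\cdot\|$ is the Euclidean norm of vectors. For $C\in\mathbb R^{r\times d}$: $C_i$ is the $i$-th column, $\mathcal I_C:=\{i\in[d]:C_i\ne0\}$, $\mathrm{nnzc}(C):=|\mathcal I_C|$; for $J\subseteq[d]$, $J^c=[d]\setminus J$, $C_J$ is the submatrix of the columns indexed by $J$ (in increasing order), and $\mathcal C_J:=\{Z_J:Z\in\mathcal C\}$ for a set $\mathcal C\subseteq\mathbb R^{r\times d}$. If $J=\emptyset$, conditions on columns indexed by $J$ are vacuous and $MN^{\mathbb T}$ is the zero matrix. $\Omega^1:=\{X\in\mathbb R^{m\times d}:\|X_i\|\le\varsigma\ \forall i\in[d]\}$, $\Omega^2:=\{Y\in\mathbb R^{n\times d}:\|Y_i\|\le\varsigma\ \forall i\in[d]\}$. $N_{\mathcal S}(Z)$ is the normal cone of convex analysis to a closed convex set $\mathcal S$ at $Z$. $\partial$ denotes the limiting subdifferential: the regular subdifferential $\widehat\partial h(X)$ is the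 set of $\zeta$ with $\liminf_{Z\to X,Z\ne X}\frac{h(Z)-h(X)-\langle\zeta,Z-X\rangle}{\|Z-X\|_F}\ge0$, and $\zeta\in\partial h(X)$ iff there are $X^k\to X$, $h(X^k)\to h(X)$, $\zeta^k\in\widehat\partial h(X^k)$ with $\zeta^k\to\zeta$. $\partial_Zf(XY^{\mathbb T}):=\partial f(Z)|_{Z=XY^{\mathbb T}}$. Stationary point of $(P_0)$: $(X,Y)\in\Omega^1\times\Omega^2$ such that for some $H\in\partial_Zf(XY^{\mathbb T})$, with $\mathcal I=\mathcal I_X\cap\mathcal I_Y$, $0\in HY_{\mathcal I}+N_{\Omega^1_{\mathcal I}}(X_{\mathcal I})$ and $0\in H^{\mathbb T}X_{\mathcal I}+N_{\Omega^2_{\mathcal I}}(Y_{\mathcal I})$. *)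

theory Defs
  imports "HOL-Analysis.Analysis"
begin

definition regular_subdifferential :: "('a::real_inner \<Rightarrow> real) \<Rightarrow> 'a \<Rightarrow> 'a set" where
  "regular_subdifferential h x =
     {\<zeta>. Liminf (at x) (\<lambda>z. ereal ((h z - h x - inner \<zeta> (z - x)) / norm (z - x))) \<ge> 0}"

definition limiting_subdifferential :: "('a::real_inner \<Rightarrow> real) \<Rightarrow> 'a \<Rightarrow> 'a set" where
  "limiting_subdifferential h x =
     {\<zeta>. \<exists>xs \<zeta>s. xs \<longlonglongrightarrow> x \<and> (\<lambda>k. h (xs k)) \<longlonglongrightarrow> h x \<and>
        (\<forall>k. \<zeta>s k \<in> regular_subdifferential h (xs k)) \<and> \<zeta>s \<longlonglongrightarrow> \<zeta>}"

definition locally_Lipschitz :: "('a::metric_space \<Rightarrow> 'b::metric_space) \<Rightarrow> bool" where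
  "locally_Lipschitz h \<longleftrightarrow> (\<forall>x. \<exists>u>0. \<exists>L. L-lipschitz_on (ball x u) h)"

definition local_min_on :: "('a::topological_space \<Rightarrow> real) \<Rightarrow> 'a set \<Rightarrow> 'a \<Rightarrow> bool" where
  "local_min_on h S x \<longleftrightarrow> x \<in> S \<and> (\<forall>\<^sub>F y in at x within S. h x \<le> h y)"

definition nz_cols :: "real^'d^'r \<Rightarrow> 'd set" where
  "nz_cols C = {i. column i C \<noteq> 0}"

definition nnzc :: "real^'d^'r \<Rightarrow> nat" where
  "nnzc C = card (nz_cols C)"

definition common_cols :: "real^'d^'m \<Rightarrow> real^'d^'n \<Rightarrow> 'd set" where
  "common_cols X Y = nz_cols X \<inter> nz_cols Y"

definition col_ball :: "real \<Rightarrow> (real^'d^'r) set" where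
  "col_ball \<sigma> = {C. \<forall>i. norm (column i C) \<le> \<sigma>}"

text \<open>
  The number of columns of a submatrix \<open>C\<^sub>J\<close> depends on \<open>J\<close> and may be zero, so it cannot be the
  index type of a vector. A real matrix with \<open>k\<close> columns, each indexed by \<open>'r\<close>, is therefore
  represented by its sequence of columns, numbered from 0: an element of \<open>col_matrices k\<close>.
  On this set the product topology of the function type is the usual topology of the
  matrix space.
\<close>

definition col_matrices :: "nat \<Rightarrow> (nat \<Rightarrow> real^'r) set" where
  "col_matrices k = {..<k} \<rightarrow>\<^sub>E UNIV"

definition submat :: "real^('d::{finite,linorder})^'r \<Rightarrow> 'd set \<Rightarrow> nat \<Rightarrow> real^'r" where
  "submat C J = (\<lambda>k\<in>{..<card J}. column (sorted_list_of_set J ! k) C)"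

text \<open>The product \<open>M N\<^sup>T\<close> of two matrices with \<open>k\<close> columns each.\<close>

definition mult_transpose :: "nat \<Rightarrow> (nat \<Rightarrow> real^'m) \<Rightarrow> (nat \<Rightarrow> real^'n) \<Rightarrow> real^'n^'m" where
  "mult_transpose k M N = (\<chi> i j. \<Sum>l<k. M l $ i * N l $ j)"

text \<open>
  Normal cone in the space of matrices with \<open>k\<close> columns; the sum is the Frobenius inner product.
\<close>

definition normal_cone :: "nat \<Rightarrow> (nat \<Rightarrow> real^'r) set \<Rightarrow> (nat \<Rightarrow> real^'r) \<Rightarrow> (nat \<Rightarrow> real^'r) set" where
  "normal_cone k S Z =
     (if Z \<in> S then {V \<in> col_matrices k. \<forall>W\<in>S. (\<Sum>l<k. inner (V l) (W l - Z l)) \<le> 0} else {})"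

definition sub_col_ball :: "real \<Rightarrow> ('d::{finite,linorder}) set \<Rightarrow> (nat \<Rightarrow> real^'r) set" where
  "sub_col_ball \<sigma> J = (\<lambda>Z :: real^('d::{finite,linorder})^'r. submat Z J) ` col_ball \<sigma>"

definition sub_feasible ::
    "real \<Rightarrow> real^('d::{finite,linorder})^'m \<Rightarrow> real^('d::{finite,linorder})^'n
      \<Rightarrow> ((nat \<Rightarrow> real^'m) \<times> (nat \<Rightarrow> real^'n)) set" where
  "sub_feasible \<sigma> X Y = sub_col_ball \<sigma> (common_cols X Y) \<times> sub_col_ball \<sigma> (common_cols X Y)"

definition keep_cols :: "'d set \<Rightarrow> real^'d^'r \<Rightarrow> real^'d^'r" where
  "keep_cols J C = (\<chi> i j. if j \<in> J then C $ i $ j else 0)"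

definition F0 :: "(real^'n^'m \<Rightarrow> real) \<Rightarrow> real \<Rightarrow> real^'d^'m \<Rightarrow> real^'d^'n \<Rightarrow> real" where
  "F0 f lam X Y = f (X ** transpose Y) + lam * (real (nnzc X) + real (nnzc Y))"

definition global_minimizers ::
    "(real^'n^'m \<Rightarrow> real) \<Rightarrow> real \<Rightarrow> real \<Rightarrow> ((real^'d^'m) \<times> (real^'d^'n)) set" where
  "global_minimizers f lam \<sigma> =
     {p. is_arg_min (\<lambda>(X, Y). F0 f lam X Y) (\<lambda>p. p \<in> col_ball \<sigma> \<times> col_ball \<sigma>) p}"

definition local_minimizers ::
    "(real^'n^'m \<Rightarrow> real) \<Rightarrow> real \<Rightarrow> real \<Rightarrow> ((real^'d^'m) \<times> (real^'d^'n)) set" where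
  "local_minimizers f lam \<sigma> =
     {p. local_min_on (\<lambda>(X, Y). F0 f lam X Y) (col_ball \<sigma> \<times> col_ball \<sigma>) p}"

text \<open>
  Column \<open>l\<close> of \<open>H Y\<^sub>I\<close> is \<open>H\<close> applied to column \<open>l\<close> of \<open>Y\<^sub>I\<close>, and likewise for the transpose.
\<close>

definition stationary_points ::
    "(real^'n^'m \<Rightarrow> real) \<Rightarrow> real
      \<Rightarrow> ((real^('d::{finite,linorder})^'m) \<times> (real^('d::{finite,linorder})^'n)) set" where
  "stationary_points f \<sigma> =
     {(X, Y). (X, Y) \<in> col_ball \<sigma> \<times> col_ball \<sigma> \<and>
        (\<exists>H \<in> limiting_subdifferential f (X ** transpose Y).
           let I = common_cols X Y; k = card I in
           (\<exists>V \<in> normal_cone k (sub_col_ball \<sigma> I) (submat X I).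
              \<forall>l<k. 0 = H *v submat Y I l + V l) \<and>
           (\<exists>W \<in> normal_cone k (sub_col_ball \<sigma> I) (submat Y I).
              \<forall>l<k. 0 = transpose H *v submat X I l + W l))}"

end

theory Submission imports Defs begin

text \<open>
  Only the columns that are nonzero in both factors contribute to \<open>X ** transpose Y\<close>, while the
  penalty counts all nonzero columns. Deleting the other columns therefore keeps the product and
  lowers the penalty; this gives column consistency of global minimizers
  (\<open>global_minimizer_column_consistent\<close>).

  Locally the penalty is a discrete quantity: near \<open>(X, Y)\<close> nonzero columns persist, so either the
  penalty is unchanged or it jumps up by at least \<open>lam\<close>, and a jump beats any small change of \<open>f\<close>.
  Hence local minimality is local minimality of \<open>f\<close> of the product with all columns outside
  \<open>common_cols X Y\<close> fixed to zero (\<open>local_minimizer_iff_supported\<close>), which is the submatrix problem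
  up to a homeomorphism (\<open>local_minimizer_iff_submat\<close>). As the criterion involves the common columns
  only, dropping the other columns preserves local minimality and, likewise, stationarity.

  The reduced problem minimises \<open>f\<close> composed with a smooth map over a convex set. Its stationarity
  condition needs a single limiting subgradient \<open>H\<close> that serves both factors. It is obtained from a
  quadratic penalty that decouples the argument of \<open>f\<close> from the product
  (\<open>multiplier_of_local_min_composition\<close>): the penalised minimizers come with regular subgradients,
  which are bounded in terms of the local Lipschitz constant and so converge along a subsequence.

  Rescaling leaves the objective unchanged. For global minimizers this is all that is needed. For local
  minimizers one has to map a neighbourhood of the rescaled pair back into the feasible set; a
  continuous columnwise correction achieves this (\<open>local_minimizer_rescale_ge_1\<close>).
\<close>

section \<open>Local minima and regular subgradients\<close>

text \<open>
  Along the segment from \<open>x\<close> to \<open>w\<close>, which stays in \<open>C\<close> by convexity, a negative derivative would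
  make \<open>g\<close> drop below \<open>g x\<close>.
\<close>
lemma derivative_nonneg_at_min_on_convex:
  fixes g :: "'a::real_normed_vector \<Rightarrow> real"
  assumes "convex C" "x \<in> C" "w \<in> C" and U: "open U" "x \<in> U"
    and D: "(g has_derivative D) (at x)"
    and min: "\<And>y. y \<in> C \<Longrightarrow> y \<in> U \<Longrightarrow> g x \<le> g y"
  shows "0 \<le> D (w - x)"
proof (rule ccontr)
  assume neg: "\<not> 0 \<le> D (w - x)"
  define p where "p t = x + t *\<^sub>R (w - x)" for t :: real
  have p0: "p 0 = x" by (simp add: p_def)
  have dp: "(p has_derivative (\<lambda>t. t *\<^sub>R (w - x))) (at 0)"
    unfolding p_def by (auto intro!: derivative_eq_intros)
  have "((\<lambda>t. g (p t)) has_derivative (\<lambda>t. D (t *\<^sub>R (w - x)))) (at 0)"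
    using has_derivative_compose[OF dp, of g D] D p0 by simp
  then have "((\<lambda>t. g (p t)) has_real_derivative D (w - x)) (at 0)"
    using has_derivative_linear[OF D]
    by (simp add: has_field_derivative_def linear_cmul mult_commute_abs)
  then obtain e where e: "e > 0" "\<And>t. 0 < t \<Longrightarrow> t < e \<Longrightarrow> g (p t) < g (p 0)"
    using has_real_derivative_neg_dec_right[of "\<lambda>t. g (p t)" "D (w - x)" 0 UNIV] neg by auto
  have "isCont p 0"
    unfolding p_def by (intro continuous_intros)
  then have "(p \<longlongrightarrow> x) (at_right 0)"
    using p0 by (metis isContD filterlim_at_split)
  then have "\<forall>\<^sub>F t in at_right 0. p t \<in> U"
    using U by (simp add: topological_tendstoD)
  moreover have "\<forall>\<^sub>F t in at_right (0::real). t < min 1 e"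
    using e by (intro order_tendstoD(2)[OF tendsto_ident_at]) auto
  moreover have "\<forall>\<^sub>F t in at_right (0::real). t > 0"
    by (simp add: eventually_at_right_less)
  ultimately have "\<forall>\<^sub>F t in at_right (0::real). False"
  proof eventually_elim
    case (elim t)
    have "p t = (1 - t) *\<^sub>R x + t *\<^sub>R w"
      by (simp add: p_def algebra_simps)
    then have "p t \<in> C"
      using elim assms(1-3) by (simp add: convex_alt)
    then show ?case
      using min[of "p t"] elim e(2)[of t] p0 by auto
  qed
  then show False by simp
qed

text \<open>
  The error \<open>c * norm (z - x)\<^sup>2\<close> is of smaller order than \<open>norm (z - x)\<close>. This is how regular
  subgradients of \<open>f\<close> arise here: when \<open>f\<close> plus a quadratic penalty has a minimum at a point, the
  negative gradient of the penalty there satisfies the premise.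
\<close>
lemma regular_subdifferentialI_quadratic:
  fixes h :: "'a::real_inner \<Rightarrow> real"
  assumes "\<forall>\<^sub>F z in at x. h z \<ge> h x + inner \<zeta> (z - x) - c * (norm (z - x))\<^sup>2"
  shows "\<zeta> \<in> regular_subdifferential h x"
proof (cases "at x = (bot :: 'a filter)")
  case True
  then show ?thesis by (simp add: regular_subdifferential_def)
next
  case False
  have "((\<lambda>z. - c * norm (z - x)) \<longlongrightarrow> - c * norm (x - x)) (at x)"
    by (intro tendsto_intros)
  then have "((\<lambda>z. ereal (- c * norm (z - x))) \<longlongrightarrow> 0) (at x)"
    by (simp add: zero_ereal_def)
  then have "Liminf (at x) (\<lambda>z. ereal (- c * norm (z - x))) = 0"
    using False by (simp add: lim_imp_Liminf)
  moreover have "\<forall>\<^sub>F z in at x. ereal (- c * norm (z - x))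
       \<le> ereal ((h z - h x - inner \<zeta> (z - x)) / norm (z - x))"
    using assms eventually_neq_at_within[of x x UNIV]
  proof eventually_elim
    case (elim z)
    then show ?case by (simp add: field_simps power2_eq_square)
  qed
  then have "Liminf (at x) (\<lambda>z. ereal (- c * norm (z - x)))
      \<le> Liminf (at x) (\<lambda>z. ereal ((h z - h x - inner \<zeta> (z - x)) / norm (z - x)))"
    by (rule Liminf_mono)
  ultimately show ?thesis by (simp add: regular_subdifferential_def)
qed

lemma local_min_on_iff_open:
  "local_min_on h S x \<longleftrightarrow> x \<in> S \<and> (\<exists>U. open U \<and> x \<in> U \<and> (\<forall>y\<in>S \<inter> U. h x \<le> h y))"
  unfolding local_min_on_def eventually_at_topological
  by (intro conj_cong refl ex_cong1) auto

text \<open>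
  Every comparison of local minima of two problems below is an instance of this transfer rule: a
  map \<open>g\<close>, continuous at \<open>y\<close>, sends competitors of \<open>y\<close> in the second problem to competitors of
  \<open>x\<close> in the first one, and increments of \<open>k\<close> dominate the corresponding increments of \<open>h\<close>.
\<close>
lemma local_min_on_pullback:
  assumes "local_min_on h S x" and "y \<in> T"
    and lim: "(g \<longlongrightarrow> x) (at y within T)"
    and S: "\<And>z. z \<in> T \<Longrightarrow> g z \<in> S"
    and le: "\<forall>\<^sub>F z in at y within T. h (g z) + k y \<le> k z + h x"
  shows "local_min_on k T y"
proof -
  obtain U where U: "open U" "x \<in> U" "\<And>u. u \<in> S \<Longrightarrow> u \<in> U \<Longrightarrow> h x \<le> h u"
    using assms(1) by (auto simp: local_min_on_iff_open)
  have "\<forall>\<^sub>F z in at y within T. g z \<in> U"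
    using lim U by (simp add: topological_tendstoD)
  moreover have "\<forall>\<^sub>F z in at y within T. z \<in> T"
    by (simp add: eventually_at_filter)
  ultimately have "\<forall>\<^sub>F z in at y within T. k y \<le> k z"
    using le
  proof eventually_elim
    case (elim z)
    then show ?case using U(3)[of "g z"] S[of z] by auto
  qed
  then show ?thesis using assms(2) by (simp add: local_min_on_def)
qed

lemma locally_Lipschitz_imp_isCont:
  assumes "locally_Lipschitz f"
  shows "isCont f x"
proof -
  obtain u L where "u > 0" "L-lipschitz_on (ball x u) f"
    using assms unfolding locally_Lipschitz_def by blast
  then have "continuous_on (ball x u) f"
    by (simp add: lipschitz_on_continuous_on)
  then show ?thesis
    using \<open>u > 0\<close> continuous_on_eq_continuous_at[of "ball x u" f] by simp
qed

section \<open>A multiplier rule for composite functions on convex sets\<close>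

text \<open>
  A chain rule for the limiting subdifferential together with Fermat's rule on a convex set,
  proved at once by a quadratic penalty. Decouple the inner value: on a compact neighbourhood,
  minimise \<open>f z + k / 2 * norm (z - \<Phi> x)\<^sup>2 + norm (x - x0)\<^sup>2 / 2\<close> over \<open>x \<in> C\<close> and \<open>z\<close>, and let
  \<open>(x k, z k)\<close> be a minimiser. Optimality in \<open>z\<close> makes \<open>H k = k (\<Phi> (x k) - z k)\<close> a regular
  subgradient of \<open>f\<close> at \<open>z k\<close>; optimality in \<open>x\<close> is a smooth variational inequality on \<open>C\<close> with the
  same \<open>H k\<close>. Comparison with \<open>(x0, \<Phi> x0)\<close> and the Lipschitz bound give \<open>norm (H k) \<le> 2 L\<close>
  and the convergence of \<open>(x k, z k)\<close> to \<open>(x0, \<Phi> x0)\<close>, so a limit point of \<open>H k\<close> is the multiplier.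
\<close>
lemma multiplier_of_local_min_composition:
  fixes f :: "'b::euclidean_space \<Rightarrow> real" and \<Phi> :: "'a::euclidean_space \<Rightarrow> 'b"
  assumes lip: "locally_Lipschitz f"
    and C: "closed C" "convex C"
    and \<Phi>: "\<And>x. (\<Phi> has_derivative D x) (at x)"
    and D_cont: "\<And>v. isCont (\<lambda>p. D (fst p) (snd p)) (x0, v)"
    and loc: "local_min_on (\<lambda>x. f (\<Phi> x)) C x0"
  shows "\<exists>H\<in>limiting_subdifferential f (\<Phi> x0). \<forall>w\<in>C. 0 \<le> inner H (D x0 (w - x0))"
proof -
  define z0 where "z0 = \<Phi> x0"
  have \<Phi>_isCont: "isCont \<Phi> x" for x
    using \<Phi> has_derivative_continuous by blast
  then have \<Phi>_cont: "continuous_on S \<Phi>" for S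
    by (simp add: continuous_at_imp_continuous_on)
  have x0C: "x0 \<in> C"
    using loc by (simp add: local_min_on_def)
  obtain u L where u: "u > 0" and L: "L-lipschitz_on (ball z0 u) f"
    using lip unfolding locally_Lipschitz_def by blast
  define \<rho> where "\<rho> = u / 2"
  have \<rho>: "\<rho> > 0" "cball z0 \<rho> \<subseteq> ball z0 u"
    using u by (auto simp: \<rho>_def)
  have fL: "\<bar>f a - f b\<bar> \<le> L * norm (a - b)" 
      if "a \<in> cball z0 \<rho>" "b \<in> cball z0 \<rho>" for a b
    using lipschitz_onD[OF L, of a b] that \<rho>(2) by (simp add: dist_norm subset_iff)
  have L0: "L \<ge> 0" using lipschitz_on_nonneg[OF L] .
  obtain U where U: "open U" "x0 \<in> U" "\<And>x. x \<in> C \<Longrightarrow> x \<in> U \<Longrightarrow> f z0 \<le> f (\<Phi> x)"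
    using loc by (auto simp: local_min_on_iff_open z0_def)
  have "open (\<Phi> -` ball z0 \<rho>)"
    using \<Phi>_cont by (simp add: open_vimage)
  then have "open (U \<inter> \<Phi> -` ball z0 \<rho>)" "x0 \<in> U \<inter> \<Phi> -` ball z0 \<rho>"
    using U \<rho> by (auto simp: z0_def)
  then obtain r where r: "r > 0" "cball x0 r \<subseteq> U \<inter> \<Phi> -` ball z0 \<rho>"
    using open_contains_cball by blast
  \<comment> \<open>The radius \<open>r\<close> keeps \<open>\<Phi> x\<close> in the ball of radius \<open>\<rho>\<close>, so that \<open>f\<close> at \<open>z\<close> and at \<open>\<Phi> x\<close> can be compared.\<close>
  define K where "K = (C \<inter> cball x0 r) \<times> cball z0 \<rho>"
  define P where "P k = (\<lambda>(x, z). f z + real k / 2 * (norm (z - \<Phi> x))\<^sup>2 + (norm (x - x0))\<^sup>2 / 2)" for k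
  have K: "compact K" "(x0, z0) \<in> K"
    using C x0C r \<rho> by (auto simp: K_def intro!: compact_Times closed_Int_compact)
  have f_cont: "continuous_on S f" for S
    using locally_Lipschitz_imp_isCont[OF lip] by (simp add: continuous_at_imp_continuous_on)
  have P_cont: "continuous_on K (P k)" for k
    unfolding P_def case_prod_beta
    by (intro continuous_intros continuous_on_compose2[OF f_cont] continuous_on_compose2[OF \<Phi>_cont])
       (auto intro: continuous_intros)
  have "\<exists>q\<in>K. \<forall>p\<in>K. P k q \<le> P k p" for k
    using continuous_attains_inf[OF K(1) _ P_cont] K(2) by blast
  then obtain q where q: "\<And>k. q k \<in> K" "\<And>k p. p \<in> K \<Longrightarrow> P k (q k) \<le> P k p"
    by metis
  define x where "x k = fst (q k)" for k
  define z where "z k = snd (q k)" for k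
  define H where "H k = real k *\<^sub>R (\<Phi> (x k) - z k)" for k
  have xC: "x k \<in> C" "x k \<in> cball x0 r" and zB: "z k \<in> cball z0 \<rho>" for k
    using q(1)[of k] by (auto simp: K_def x_def z_def mem_Times_iff)
  have \<Phi>B: "\<Phi> y \<in> cball z0 \<rho>" "y \<in> U" if "y \<in> cball x0 r" for y
    using r(2) that by (auto simp: subset_iff intro: less_imp_le)
  have min: "P k (x k, z k) \<le> P k p" if "p \<in> K" for k p
    using q(2)[OF that, of k] by (simp add: x_def z_def)
  \<comment> \<open>The value at \<open>(x0, z0)\<close> is \<open>f z0 \<le> f (\<Phi> (x k))\<close>, by local minimality of \<open>x0\<close>; the Lipschitz bound moves this to \<open>z k\<close>.\<close>
  have est: "real k / 2 * (norm (z k - \<Phi> (x k)))\<^sup>2 + (norm (x k - x0))\<^sup>2 / 2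
      \<le> L * norm (z k - \<Phi> (x k))" for k
  proof -
    have "P k (x k, z k) \<le> f z0"
      using min[OF K(2), of k] by (simp add: P_def z0_def)
    also have "\<dots> \<le> f (\<Phi> (x k))"
      using U(3) xC \<Phi>B(2) by blast
    also have "\<dots> \<le> f (z k) + L * norm (z k - \<Phi> (x k))"
      using fL[OF zB[of k] \<Phi>B(1)[OF xC(2)[of k]]] by linarith
    finally show ?thesis by (simp add: P_def)
  qed
  have H_bound: "norm (H k) \<le> 2 * L" for k
  proof (cases "norm (z k - \<Phi> (x k)) = 0")
    case True
    then show ?thesis using L0 by (simp add: H_def)
  next
    case False
    have "real k / 2 * norm (z k - \<Phi> (x k)) * norm (z k - \<Phi> (x k)) \<le> L * norm (z k - \<Phi> (x k))"
      using est[of k] zero_le_power2[of "norm (x k - x0)"]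
      unfolding power2_eq_square mult.assoc by linarith
    then have "real k / 2 * norm (z k - \<Phi> (x k)) \<le> L"
      by (rule mult_right_le_imp_le) (use False in simp)
    then show ?thesis by (simp add: H_def norm_minus_commute)
  qed
  have d_bound: "norm (z k - \<Phi> (x k)) \<le> 2 * L / real k" if "k > 0" for k
  proof -
    have "real k * norm (z k - \<Phi> (x k)) \<le> 2 * L"
      using H_bound[of k] by (simp add: H_def norm_minus_commute)
    then show ?thesis using that by (simp add: pos_le_divide_eq mult.commute)
  qed
  have lim0: "(\<lambda>k. c / real k) \<longlonglongrightarrow> 0" for c
    by (rule tendsto_divide_0[OF tendsto_const]) (simp add: filterlim_at_top_imp_at_infinity filterlim_real_sequentially)
  have d_lim: "(\<lambda>k. z k - \<Phi> (x k)) \<longlonglongrightarrow> 0"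
    by (rule Lim_null_comparison[OF _ lim0[of "2 * L"]])
       (use d_bound in \<open>auto simp: eventually_sequentially intro!: exI[of _ 1]\<close>)
  have "(\<lambda>k. (norm (x k - x0))\<^sup>2) \<longlonglongrightarrow> 0"
  proof (rule Lim_null_comparison)
    have "(norm (x k - x0))\<^sup>2 \<le> 2 * L * norm (z k - \<Phi> (x k))" for k
    proof -
      have "0 \<le> real k / 2 * (norm (z k - \<Phi> (x k)))\<^sup>2" by simp
      with est[of k] show ?thesis unfolding mult.assoc by linarith
    qed
    then show "\<forall>\<^sub>F k in sequentially. norm ((norm (x k - x0))\<^sup>2) \<le> 2 * L * norm (z k - \<Phi> (x k))"
      by simp
    show "(\<lambda>k. 2 * L * norm (z k - \<Phi> (x k))) \<longlonglongrightarrow> 0"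
      using tendsto_mult_right_zero[OF tendsto_norm_zero[OF d_lim]] by simp
  qed
  then have "(\<lambda>k. sqrt ((norm (x k - x0))\<^sup>2)) \<longlonglongrightarrow> sqrt 0"
    by (rule tendsto_real_sqrt)
  then have x_lim: "x \<longlonglongrightarrow> x0"
    by (simp add: tendsto_norm_zero_iff LIM_zero_iff)
  have "(\<lambda>k. (z k - \<Phi> (x k)) + \<Phi> (x k)) \<longlonglongrightarrow> 0 + \<Phi> x0"
    by (intro tendsto_add d_lim isCont_tendsto_compose[OF \<Phi>_isCont x_lim])
  then have z_lim: "z \<longlonglongrightarrow> z0" by (simp add: z0_def)
  have sub: "H k \<in> regular_subdifferential f (z k)" if "z k \<in> ball z0 \<rho>" for k
  proof (rule regular_subdifferentialI_quadratic[where c = "real k / 2"])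
    have "\<forall>\<^sub>F y in at (z k). y \<in> ball z0 \<rho>"
      by (rule eventually_at_in_open'[OF open_ball that])
    then show "\<forall>\<^sub>F y in at (z k). f y \<ge> f (z k) + inner (H k) (y - z k) - real k / 2 * (norm (y - z k))\<^sup>2"
    proof eventually_elim
      case (elim y)
      then have "P k (x k, z k) \<le> P k (x k, y)"
        using xC[of k] by (intro min) (auto simp: K_def)
      then show ?case
        by (simp add: P_def H_def power2_norm_eq_inner inner_diff algebra_simps inner_commute)
    qed
  qed
  have var: "0 \<le> inner (H k) (D (x k) (w - x k)) + inner (x k - x0) (w - x k)"
    if w: "w \<in> C" and k: "x k \<in> ball x0 r" for k w
  proof -
    define g where "g = (\<lambda>y. P k (y, z k))"
    have "(g has_derivative (\<lambda>v. inner (H k) (D (x k) v) + inner (x k - x0) v)) (at (x k))"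
      unfolding g_def P_def H_def power2_norm_eq_inner prod.case
      by (auto intro!: derivative_eq_intros \<Phi> simp: fun_eq_iff inner_commute algebra_simps inner_diff diff_divide_distrib)
    then show ?thesis
    proof (rule derivative_nonneg_at_min_on_convex[OF C(2) xC(1) w open_ball k])
      fix y assume "y \<in> C" "y \<in> ball x0 r"
      then show "g (x k) \<le> g y"
        unfolding g_def using zB[of k] by (intro min) (auto simp: K_def)
    qed
  qed
  have H_cball: "H k \<in> cball 0 (2 * L)" for k
    using H_bound[of k] by simp
  then obtain H' s where s: "strict_mono s" and H_lim: "(H \<circ> s) \<longlonglongrightarrow> H'"
    using compact_cball[of "0::'b" "2 * L"] unfolding compact_def by metis
  have xs_lim: "(\<lambda>k. x (s k)) \<longlonglongrightarrow> x0" and zs_lim: "(\<lambda>k. z (s k)) \<longlonglongrightarrow> z0"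
    using LIMSEQ_subseq_LIMSEQ[OF x_lim s] LIMSEQ_subseq_LIMSEQ[OF z_lim s] by (simp_all add: o_def)
  have ev: "\<forall>\<^sub>F k in sequentially. x (s k) \<in> ball x0 r \<and> z (s k) \<in> ball z0 \<rho>"
    using topological_tendstoD[OF xs_lim open_ball, of x0 r] topological_tendstoD[OF zs_lim open_ball, of z0 \<rho>]
      r \<rho> by (simp add: eventually_conj)
  \<comment> \<open>A subgradient is required at every index of the sequence, so its first \<open>N\<close> terms are dropped.\<close>
  then obtain N where N: "\<And>k. k \<ge> N \<Longrightarrow> z (s k) \<in> ball z0 \<rho>"
    by (auto simp: eventually_sequentially)
  have "H' \<in> limiting_subdifferential f z0"
    unfolding limiting_subdifferential_def
  proof (intro CollectI exI conjI allI)
    show "(\<lambda>k. z (s (k + N))) \<longlonglongrightarrow> z0"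
      using LIMSEQ_ignore_initial_segment[OF zs_lim] .
    then show "(\<lambda>k. f (z (s (k + N)))) \<longlonglongrightarrow> f z0"
      by (rule isCont_tendsto_compose[OF locally_Lipschitz_imp_isCont[OF lip]])
    show "H (s (k + N)) \<in> regular_subdifferential f (z (s (k + N)))" for k
      using N by (intro sub) simp
    show "(\<lambda>k. H (s (k + N))) \<longlonglongrightarrow> H'"
      using LIMSEQ_ignore_initial_segment[OF H_lim, of N] by (simp add: o_def)
  qed
  moreover have "0 \<le> inner H' (D x0 (w - x0))" if w: "w \<in> C" for w
  proof (rule tendsto_lowerbound)
    have "(\<lambda>k. (x (s k), w - x (s k))) \<longlonglongrightarrow> (x0, w - x0)"
      by (intro tendsto_intros xs_lim)
    from isCont_tendsto_compose[OF D_cont this]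
    have "(\<lambda>k. D (x (s k)) (w - x (s k))) \<longlonglongrightarrow> D x0 (w - x0)" by simp
    then have "(\<lambda>k. inner (H (s k)) (D (x (s k)) (w - x (s k))) + inner (x (s k) - x0) (w - x (s k)))
        \<longlonglongrightarrow> inner H' (D x0 (w - x0)) + inner (x0 - x0) (w - x0)"
      using H_lim[unfolded o_def] by (intro tendsto_intros xs_lim)
    then show "(\<lambda>k. inner (H (s k)) (D (x (s k)) (w - x (s k))) + inner (x (s k) - x0) (w - x (s k)))
        \<longlonglongrightarrow> inner H' (D x0 (w - x0))" by simp
    show "\<forall>\<^sub>F k in sequentially. 0 \<le> inner (H (s k)) (D (x (s k)) (w - x (s k))) + inner (x (s k) - x0) (w - x (s k))"
      using ev by eventually_elim (use var w in auto)
  qed simp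
  ultimately show ?thesis unfolding z0_def by blast
qed

section \<open>Columns, column supports and products\<close>

text \<open>
  Fixing the column set as a support condition, rather than passing to submatrices, keeps all
  matrices in one Euclidean space. With \<open>I = common_cols X Y\<close>, the problem of minimising
  \<open>f (X' ** transpose Y')\<close> over \<open>supp_ball \<sigma> I \<times> supp_ball \<sigma> I\<close> is the one to which local minimality of
  the regularised objective reduces.
\<close>
definition supp_ball :: "real \<Rightarrow> 'd set \<Rightarrow> (real^'d^'r) set" where
  "supp_ball \<sigma> I = {C \<in> col_ball \<sigma>. nz_cols C \<subseteq> I}"

lemma column_keep_cols: "column i (keep_cols I C) = (if i \<in> I then column i C else 0)"
  by (simp add: keep_cols_def column_def vec_eq_iff)

lemma matrix_eq_columnsI: "(\<And>i. column i A = column i B) \<Longrightarrow> A = B"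
  by (simp add: column_def vec_eq_iff)

lemma column_add: "column i (A + B) = column i A + column i B"
  by (simp add: column_def vec_eq_iff)

lemma column_diff: "column i (A - B) = column i A - column i (B :: real^'d^'r)"
  by (simp add: column_def vec_eq_iff)

lemma column_scaleR: "column i (c *\<^sub>R A) = c *\<^sub>R column i A"
  by (simp add: column_def vec_eq_iff)

lemma bounded_linear_column: "bounded_linear (column i :: real^'d^'r \<Rightarrow> _)"
  by (intro linear_conv_bounded_linear[THEN iffD1] linearI)
     (simp_all add: column_add column_scaleR)

lemmas tendsto_column [tendsto_intros] = bounded_linear.tendsto[OF bounded_linear_column]
lemmas continuous_on_column [continuous_intros] = bounded_linear.continuous_on[OF bounded_linear_column]

lemma bounded_linear_keep_cols: "bounded_linear (keep_cols I :: real^'d^'r \<Rightarrow> _)"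
  by (intro linear_conv_bounded_linear[THEN iffD1] linearI)
     (simp_all add: keep_cols_def vec_eq_iff)

lemma nz_cols_keep_cols [simp]: "nz_cols (keep_cols I C) = I \<inter> nz_cols C"
  by (auto simp: nz_cols_def column_keep_cols)

lemma keep_cols_id: "nz_cols C \<subseteq> I \<Longrightarrow> keep_cols I C = C"
  by (intro matrix_eq_columnsI) (auto simp: nz_cols_def column_keep_cols)

lemma keep_cols_in_col_ball: "0 \<le> \<sigma> \<Longrightarrow> C \<in> col_ball \<sigma> \<Longrightarrow> keep_cols I C \<in> col_ball \<sigma>"
  by (simp add: col_ball_def column_keep_cols)

lemma keep_cols_in_supp_ball: "0 \<le> \<sigma> \<Longrightarrow> C \<in> col_ball \<sigma> \<Longrightarrow> keep_cols I C \<in> supp_ball \<sigma> I"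
  by (simp add: supp_ball_def keep_cols_in_col_ball)

lemma bounded_bilinear_mult_transpose:
  "bounded_bilinear (\<lambda>(X::real^'d^'m) (Y::real^'d^'n). X ** transpose Y)"
  by (intro bilinear_conv_bounded_bilinear[THEN iffD1])
     (simp add: bilinear_def linear_iff matrix_matrix_mult_def transpose_def vec_eq_iff
        distrib_left distrib_right sum.distrib sum_distrib_left mult.assoc mult.left_commute)

lemmas tendsto_mult_transpose = bounded_bilinear.tendsto[OF bounded_bilinear_mult_transpose]

text \<open>
  The product is the sum over \<open>l\<close> of the rank-one matrices built from the two columns \<open>l\<close>, and such
  a matrix vanishes as soon as one of its columns does.
\<close>
lemma mult_transpose_cong_columns:
  fixes X X' :: "real^'d^'m" and Y Y' :: "real^'d^'n"
  assumes "\<And>l. (column l X = column l X' \<and> column l Y = column l Y')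
      \<or> ((column l X = 0 \<or> column l Y = 0) \<and> (column l X' = 0 \<or> column l Y' = 0))"
  shows "X ** transpose Y = X' ** transpose Y'"
proof -
  have "column l X $ i * column l Y $ j = column l X' $ i * column l Y' $ j" for i j l
    using assms[of l] by (elim disjE conjE) simp_all
  then have "X $ i $ l * Y $ j $ l = X' $ i $ l * Y' $ j $ l" for i j l
    by (simp add: column_def)
  then show ?thesis
    by (simp add: matrix_matrix_mult_def transpose_def vec_eq_iff)
qed

lemma mult_transpose_keep_common_cols:
  "common_cols X Y \<subseteq> I \<Longrightarrow> keep_cols I X ** transpose (keep_cols I Y) = X ** transpose Y"
  by (intro mult_transpose_cong_columns) (auto simp: column_keep_cols common_cols_def nz_cols_def)

text \<open>
  Lower semicontinuity of the column support: small perturbations can create nonzero columns but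
  not destroy them.
\<close>
lemma eventually_nz_cols_mono:
  fixes X :: "real^'d^'r"
  assumes "(q \<longlongrightarrow> X) F"
  shows "\<forall>\<^sub>F p in F. nz_cols X \<subseteq> nz_cols (q p)"
proof -
  have "\<forall>\<^sub>F p in F. column i (q p) \<noteq> 0" if "i \<in> nz_cols X" for i
    using that by (intro tendsto_imp_eventually_ne[OF tendsto_column[OF assms]])
      (simp add: nz_cols_def)
  then have "\<forall>\<^sub>F p in F. \<forall>i\<in>nz_cols X. column i (q p) \<noteq> 0"
    by (intro eventually_ball_finite) auto
  then show ?thesis
    by eventually_elim (auto simp: nz_cols_def)
qed

lemma nnzc_keep_cols_le: "nnzc (keep_cols J C) \<le> nnzc C"
  by (simp add: nnzc_def card_mono)

text \<open>
  Adding \<open>D - keep_cols I D\<close> puts the columns of \<open>D\<close> outside \<open>I\<close> next to those of a matrix supported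
  on \<open>I\<close>.
\<close>
lemma column_replace_cols:
  fixes C D :: "real^'d^'r"
  assumes "nz_cols C \<subseteq> I"
  shows "column l (C + (D - keep_cols I D)) = (if l \<in> I then column l C else column l D)"
  using assms by (auto simp: column_add column_diff column_keep_cols nz_cols_def)

lemma replace_cols_in_col_ball:
  fixes C D :: "real^'d^'r"
  assumes "C \<in> supp_ball \<sigma> I" "D \<in> col_ball \<sigma>"
  shows "C + (D - keep_cols I D) \<in> col_ball \<sigma>"
proof -
  have C: "nz_cols C \<subseteq> I" "\<And>i. norm (column i C) \<le> \<sigma>" and D: "\<And>i. norm (column i D) \<le> \<sigma>"
    using assms by (auto simp: supp_ball_def col_ball_def)
  show ?thesis
    by (simp add: col_ball_def column_replace_cols[OF C(1)] C(2) D)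
qed

lemma F0_keep_common_cols_le:
  assumes "0 \<le> lam"
  shows "F0 f lam (keep_cols (common_cols X Y) X) (keep_cols (common_cols X Y) Y) \<le> F0 f lam X Y"
  unfolding F0_def mult_transpose_keep_common_cols[OF order_refl]
  by (intro add_left_mono mult_left_mono add_mono of_nat_mono nnzc_keep_cols_le assms)

section \<open>Column consistency of global minimizers\<close>

lemma global_minimizers_iff:
  fixes X :: "real^'d^'m" and Y :: "real^'d^'n"
  shows "(X, Y) \<in> global_minimizers f lam \<sigma> \<longleftrightarrow> X \<in> col_ball \<sigma> \<and> Y \<in> col_ball \<sigma> \<and>
    (\<forall>(A :: real^'d^'m) \<in> col_ball \<sigma>. \<forall>(B :: real^'d^'n) \<in> col_ball \<sigma>. F0 f lam X Y \<le> F0 f lam A B)"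
  by (auto simp: global_minimizers_def is_arg_min_linorder)

text \<open>
  Deleting the columns that are nonzero in only one factor leaves the product unchanged and strictly
  lowers the column count, unless there are no such columns.
\<close>
lemma global_minimizer_column_consistent:
  fixes X :: "real^'d^'m" and Y :: "real^'d^'n"
  assumes "(X, Y) \<in> global_minimizers f lam \<sigma>" "lam > 0" "\<sigma> \<ge> 0"
  shows "nz_cols X = nz_cols Y"
proof -
  let ?I = "common_cols X Y"
  have "F0 f lam X Y \<le> F0 f lam (keep_cols ?I X) (keep_cols ?I Y)"
    using assms(1,3) by (simp add: global_minimizers_iff keep_cols_in_col_ball)
  then have "nnzc X + nnzc Y \<le> nnzc (keep_cols ?I X) + nnzc (keep_cols ?I Y)"
    using assms(2) by (simp add: F0_def mult_transpose_keep_common_cols flip: of_nat_add)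
  also have "\<dots> = card ?I + card ?I"
    by (simp add: nnzc_def common_cols_def Int_commute Int_left_commute)
  finally have "card (nz_cols X) + card (nz_cols Y) \<le> card ?I + card ?I"
    by (simp add: nnzc_def)
  moreover have sub: "?I \<subseteq> nz_cols X" "?I \<subseteq> nz_cols Y" by (auto simp: common_cols_def)
  then have "card ?I \<le> card (nz_cols X)" "card ?I \<le> card (nz_cols Y)"
    by (simp_all add: card_mono)
  ultimately have "card (nz_cols X) \<le> card ?I" "card (nz_cols Y) \<le> card ?I"
    by linarith+
  then have "?I = nz_cols X" "?I = nz_cols Y"
    using sub by (simp_all add: card_seteq)
  then show ?thesis by simp
qed

section \<open>Local minimizers and the problem on the common columns\<close>

text \<open>
  From left to right, a competitor supported on the common columns is completed by the remaining
  columns of \<open>X\<close> and \<open>Y\<close>. These do not contribute to the product, and near the base point the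
  completed pair has exactly the nonzero columns of \<open>X\<close> and \<open>Y\<close>, so the penalty is the same.

  From right to left, a competitor near \<open>(X, Y)\<close> either has the same nonzero columns, and then only its
  common columns matter, or it has at least one more. In the second case the penalty grows by at
  least \<open>lam\<close>, which outweighs the small change in \<open>f\<close> caused by removing columns.
\<close>
lemma local_minimizer_iff_supported:
  fixes X :: "real^'d^'m" and Y :: "real^'d^'n"
  assumes lip: "locally_Lipschitz f" and "lam > 0" "\<sigma> \<ge> 0"
    and XY: "(X, Y) \<in> col_ball \<sigma> \<times> col_ball \<sigma>"
  defines "I \<equiv> common_cols X Y"
  shows "(X, Y) \<in> local_minimizers f lam \<sigma> \<longleftrightarrow>
    local_min_on (\<lambda>(X', Y'). f (X' ** transpose Y')) (supp_ball \<sigma> I \<times> supp_ball \<sigma> I)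
      (keep_cols I X, keep_cols I Y)"
    (is "?L \<longleftrightarrow> local_min_on ?h ?S ?s")
proof
  let ?B = "col_ball \<sigma> \<times> col_ball \<sigma> :: ((real^'d^'m) \<times> (real^'d^'n)) set"
  have sS: "?s \<in> ?S"
    using XY assms(3) by (simp add: keep_cols_in_supp_ball)
  have prod_s: "keep_cols I X ** transpose (keep_cols I Y) = X ** transpose Y"
    by (simp add: I_def mult_transpose_keep_common_cols)
  define g where "g p = (fst p + (X - keep_cols I X), snd p + (Y - keep_cols I Y))"
    for p :: "(real^'d^'m) \<times> (real^'d^'n)"
  assume L: ?L
  show "local_min_on ?h ?S ?s"
  proof (rule local_min_on_pullback[OF L[unfolded local_minimizers_def mem_Collect_eq] sS])
    have "(g \<longlongrightarrow> (fst ?s + (X - keep_cols I X), snd ?s + (Y - keep_cols I Y))) (at ?s within ?S)"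
      unfolding g_def by (intro tendsto_intros)
    then show "(g \<longlongrightarrow> (X, Y)) (at ?s within ?S)" by simp
    show "g p \<in> ?B" if "p \<in> ?S" for p
      using that XY by (cases p) (simp add: g_def replace_cols_in_col_ball)
    have lim_fst: "(fst \<longlongrightarrow> keep_cols I X) (at ?s within ?S)"
      and lim_snd: "(snd \<longlongrightarrow> keep_cols I Y) (at ?s within ?S)"
      using tendsto_fst[OF tendsto_ident_at[of ?s ?S]] tendsto_snd[OF tendsto_ident_at[of ?s ?S]] by simp_all
    have "\<forall>\<^sub>F p in at ?s within ?S. nz_cols (keep_cols I X) \<subseteq> nz_cols (fst p)"
      by (rule eventually_nz_cols_mono[OF lim_fst])
    moreover have "\<forall>\<^sub>F p in at ?s within ?S. nz_cols (keep_cols I Y) \<subseteq> nz_cols (snd p)"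
      by (rule eventually_nz_cols_mono[OF lim_snd])
    moreover have "\<forall>\<^sub>F p in at ?s within ?S. p \<in> ?S"
      by (simp add: eventually_at_filter)
    ultimately show "\<forall>\<^sub>F p in at ?s within ?S.
        (\<lambda>(X, Y). F0 f lam X Y) (g p) + ?h ?s \<le> ?h p + (\<lambda>(X, Y). F0 f lam X Y) (X, Y)"
    proof eventually_elim
      case (elim p)
      obtain A B where p: "p = (A, B)" by (cases p)
      have A: "nz_cols A = I" and B: "nz_cols B = I"
        using elim by (auto simp: p I_def common_cols_def supp_ball_def)
      let ?A = "A + (X - keep_cols I X)" and ?B = "B + (Y - keep_cols I Y)"
      have colA: "column l ?A = (if l \<in> I then column l A else column l X)"
        and colB: "column l ?B = (if l \<in> I then column l B else column l Y)" for l
        using A B by (simp_all only: column_replace_cols order_refl)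
      have I_iff: "column l A \<noteq> 0 \<longleftrightarrow> l \<in> I" "column l B \<noteq> 0 \<longleftrightarrow> l \<in> I" for l
        using A B by (auto simp: nz_cols_def)
      have I_XY: "l \<in> I \<longleftrightarrow> column l X \<noteq> 0 \<and> column l Y \<noteq> 0" for l
        by (auto simp: I_def common_cols_def nz_cols_def)
      have "?A ** transpose ?B = A ** transpose B"
      proof (rule mult_transpose_cong_columns)
        fix l
        show "(column l ?A = column l A \<and> column l ?B = column l B)
          \<or> ((column l ?A = 0 \<or> column l ?B = 0) \<and> (column l A = 0 \<or> column l B = 0))"
          using I_iff[of l] I_XY[of l] unfolding colA colB by (cases "l \<in> I") auto
      qed
      moreover have "column l ?A \<noteq> 0 \<longleftrightarrow> column l X \<noteq> 0" "column l ?B \<noteq> 0 \<longleftrightarrow> column l Y \<noteq> 0" for l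
        using I_iff[of l] I_XY[of l] unfolding colA colB by (cases "l \<in> I"; simp)+
      then have "nz_cols ?A = nz_cols X" "nz_cols ?B = nz_cols Y"
        by (simp_all add: nz_cols_def)
      ultimately show ?case
        by (simp add: p g_def F0_def nnzc_def prod_s)
    qed
  qed
next
  let ?B = "col_ball \<sigma> \<times> col_ball \<sigma> :: ((real^'d^'m) \<times> (real^'d^'n)) set"
  have prod_s: "keep_cols I X ** transpose (keep_cols I Y) = X ** transpose Y"
    by (simp add: I_def mult_transpose_keep_common_cols)
  define g where "g p = (keep_cols I (fst p), keep_cols I (snd p))"
    for p :: "(real^'d^'m) \<times> (real^'d^'n)"
  let ?F = "at (X, Y) within ?B"
  assume s: "local_min_on ?h ?S ?s"
  have lim_fst: "(fst \<longlongrightarrow> X) ?F" and lim_snd: "(snd \<longlongrightarrow> Y) ?F"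
    using tendsto_fst[OF tendsto_ident_at[of "(X, Y)" ?B]] tendsto_snd[OF tendsto_ident_at[of "(X, Y)" ?B]] by simp_all
  have lim_kfst: "((\<lambda>p. keep_cols I (fst p)) \<longlongrightarrow> keep_cols I X) ?F"
    and lim_ksnd: "((\<lambda>p. keep_cols I (snd p)) \<longlongrightarrow> keep_cols I Y) ?F"
    by (intro bounded_linear.tendsto[OF bounded_linear_keep_cols] lim_fst lim_snd)+
  show ?L
    unfolding local_minimizers_def mem_Collect_eq
  proof (rule local_min_on_pullback[OF s XY])
    show "(g \<longlongrightarrow> ?s) ?F"
      unfolding g_def by (intro tendsto_Pair lim_kfst lim_ksnd)
    show "g p \<in> ?S" if "p \<in> ?B" for p
      using that assms(3) by (cases p) (auto simp: g_def keep_cols_in_supp_ball)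
    \<comment> \<open>The limit of this difference is 0, so removing columns eventually changes \<open>f\<close> by less than \<open>lam\<close>.\<close>
    have "((\<lambda>p. f (fst p ** transpose (snd p)) - f (keep_cols I (fst p) ** transpose (keep_cols I (snd p))))
       \<longlongrightarrow> f (X ** transpose Y) - f (keep_cols I X ** transpose (keep_cols I Y))) ?F"
      by (intro tendsto_diff isCont_tendsto_compose[OF locally_Lipschitz_imp_isCont[OF lip]]
            tendsto_mult_transpose lim_fst lim_snd lim_kfst lim_ksnd)
    then have "\<forall>\<^sub>F p in ?F. - lam <
       f (fst p ** transpose (snd p)) - f (keep_cols I (fst p) ** transpose (keep_cols I (snd p)))"
      using \<open>lam > 0\<close> by (intro order_tendstoD(1)) (auto simp: prod_s)
    moreover have "\<forall>\<^sub>F p in ?F. nz_cols X \<subseteq> nz_cols (fst p)"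
      by (rule eventually_nz_cols_mono[OF lim_fst])
    moreover have "\<forall>\<^sub>F p in ?F. nz_cols Y \<subseteq> nz_cols (snd p)"
      by (rule eventually_nz_cols_mono[OF lim_snd])
    ultimately show "\<forall>\<^sub>F p in ?F.
       ?h (g p) + (\<lambda>(X, Y). F0 f lam X Y) (X, Y) \<le> (\<lambda>(X, Y). F0 f lam X Y) p + ?h ?s"
    proof eventually_elim
      case (elim p)
      obtain A B where p: "p = (A, B)" by (cases p)
      have sub: "nz_cols X \<subseteq> nz_cols A" "nz_cols Y \<subseteq> nz_cols B"
        using elim by (auto simp: p)
      show ?case
      proof (cases "nz_cols A = nz_cols X \<and> nz_cols B = nz_cols Y")
        case True
        then have "common_cols A B = I" by (simp add: I_def common_cols_def)
        then have "keep_cols I A ** transpose (keep_cols I B) = A ** transpose B"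
          by (simp add: mult_transpose_keep_common_cols)
        then show ?thesis
          using True by (simp add: p g_def F0_def nnzc_def prod_s)
      next
        case False
        then have "nz_cols X \<subset> nz_cols A \<or> nz_cols Y \<subset> nz_cols B"
          using sub by blast
        then have "nnzc X < nnzc A \<or> nnzc Y < nnzc B"
          unfolding nnzc_def by (metis finite psubset_card_mono)
        moreover have "nnzc X \<le> nnzc A" "nnzc Y \<le> nnzc B"
          unfolding nnzc_def by (simp_all add: card_mono sub)
        ultimately have "real (nnzc X) + real (nnzc Y) + 1 \<le> real (nnzc A) + real (nnzc B)"
          by linarith
        then have "lam * (real (nnzc X) + real (nnzc Y) + 1) \<le> lam * (real (nnzc A) + real (nnzc B))"
          using \<open>lam > 0\<close> by simp
        then show ?thesis
          using elim by (simp add: p g_def F0_def prod_s algebra_simps)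
      qed
    qed
  qed
qed

section \<open>Passage to submatrices\<close>

lemma bij_betw_sorted_list_of_set:
  fixes I :: "'d::{finite,linorder} set"
  shows "bij_betw (\<lambda>k. sorted_list_of_set I ! k) {..<card I} I"
  by (intro bij_betw_nth) auto

lemma submat_nth: "k < card I \<Longrightarrow> submat C I k = column (sorted_list_of_set I ! k) C"
  by (simp add: submat_def)

lemma sum_sorted_list_of_set:
  fixes I :: "'d::{finite,linorder} set"
  shows "(\<Sum>k<card I. g (sorted_list_of_set I ! k)) = (\<Sum>i\<in>I. g i)"
  by (rule sum.reindex_bij_betw[OF bij_betw_sorted_list_of_set])

lemma submat_keep_cols: "submat (keep_cols I C) I = submat C I"
proof -
  have "sorted_list_of_set I ! k \<in> I" if "k < card I" for k
    using that bij_betw_sorted_list_of_set[of I] by (auto simp: bij_betw_def)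
  then show ?thesis
    by (intro ext) (simp add: submat_def column_keep_cols)
qed

lemma mult_transpose_submat:
  "mult_transpose (card I) (submat X I) (submat Y I) = keep_cols I X ** transpose (keep_cols I Y)"
proof -
  have "(\<Sum>l<card I. submat X I l $ i * submat Y I l $ j)
      = (\<Sum>l\<in>UNIV. keep_cols I X $ i $ l * keep_cols I Y $ j $ l)" for i j
  proof -
    have "(\<Sum>l<card I. submat X I l $ i * submat Y I l $ j) = (\<Sum>l\<in>I. X $ i $ l * Y $ j $ l)"
      unfolding sum_sorted_list_of_set[of "\<lambda>l. X $ i $ l * Y $ j $ l" I, symmetric]
      by (intro sum.cong) (simp_all add: submat_nth column_def)
    also have "\<dots> = (\<Sum>l\<in>UNIV. keep_cols I X $ i $ l * keep_cols I Y $ j $ l)"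
      by (intro sum.mono_neutral_cong_left) (auto simp: keep_cols_def)
    finally show ?thesis .
  qed
  then show ?thesis
    by (simp add: mult_transpose_def matrix_matrix_mult_def transpose_def vec_eq_iff)
qed

text \<open>
  A continuous right inverse of \<open>\<lambda>C. submat C I\<close> on \<open>sub_col_ball \<sigma> I\<close>, with values in matrices
  supported on \<open>I\<close>.
\<close>
definition fill_cols :: "'d::{finite,linorder} set \<Rightarrow> (nat \<Rightarrow> real^'r) \<Rightarrow> real^('d::{finite,linorder})^'r" where
  "fill_cols I M =
     (\<chi> i j. if j \<in> I then M (inv_into {..<card I} (\<lambda>k. sorted_list_of_set I ! k) j) $ i else 0)"

lemma fill_cols_submat: "fill_cols I (submat C I) = keep_cols I C"
proof -
  have "submat C I (inv_into {..<card I} (\<lambda>k. sorted_list_of_set I ! k) j) = column j C"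
    if "j \<in> I" for j
    using bij_betwE[OF bij_betw_inv_into[OF bij_betw_sorted_list_of_set[of I]]] that
      bij_betw_inv_into_right[OF bij_betw_sorted_list_of_set[of I] that]
    by (simp add: submat_nth)
  then show ?thesis
    by (simp add: fill_cols_def keep_cols_def column_def vec_eq_iff)
qed

lemma continuous_on_submat: "continuous_on S (\<lambda>C. submat C I)"
proof (rule continuous_on_coordinatewise_then_product)
  show "continuous_on S (\<lambda>C. submat C I k)" for k
    by (cases "k < card I") (simp_all add: submat_def continuous_on_column continuous_on_id)
qed

lemma continuous_on_fill_cols:
  fixes I :: "'d::{finite,linorder} set"
  shows "continuous_on S (fill_cols I :: (nat \<Rightarrow> real^'r) \<Rightarrow> real^('d::{finite,linorder})^'r)"
proof -
  have "continuous_on S (\<lambda>M. if j \<in> I then M k $ i else (0::real))"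
    for j k and i :: 'r and S :: "(nat \<Rightarrow> real^'r) set"
    using continuous_on_product_coordinates[of k, THEN continuous_on_subset, of S]
    by (cases "j \<in> I") (auto intro: continuous_intros)
  then show ?thesis
    unfolding fill_cols_def by (intro continuous_on_vec_lambda)
qed

lemma submat_in_sub_col_ball: "C \<in> supp_ball \<sigma> I \<Longrightarrow> submat C I \<in> sub_col_ball \<sigma> I"
  by (simp add: supp_ball_def sub_col_ball_def)

lemma sub_col_ball_cases:
  assumes "M \<in> sub_col_ball \<sigma> I" "0 \<le> \<sigma>"
  shows "fill_cols I M \<in> supp_ball \<sigma> I" and "submat (fill_cols I M) I = M"
  using assms by (auto simp: sub_col_ball_def fill_cols_submat keep_cols_in_supp_ball submat_keep_cols)

lemma mult_transpose_submat_supp_ball: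
  "X \<in> supp_ball \<sigma> I \<Longrightarrow> Y \<in> supp_ball \<sigma> I \<Longrightarrow>
    mult_transpose (card I) (submat X I) (submat Y I) = X ** transpose Y"
  by (simp add: mult_transpose_submat supp_ball_def keep_cols_id)

text \<open>
  Restriction to the columns in \<open>I\<close> and filling up with zero columns are mutually inverse
  homeomorphisms between the two feasible sets, and they match the two objectives.
\<close>
lemma supported_local_min_iff_submat:
  fixes X :: "real^('d::{finite,linorder})^'m" and Y :: "real^('d::{finite,linorder})^'n"
  assumes "0 \<le> \<sigma>" and X: "X \<in> col_ball \<sigma>" and Y: "Y \<in> col_ball \<sigma>"
  shows "local_min_on (\<lambda>(X', Y'). f (X' ** transpose Y')) (supp_ball \<sigma> I \<times> supp_ball \<sigma> I)
      (keep_cols I X, keep_cols I Y) \<longleftrightarrow>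
    local_min_on (\<lambda>(M, N). f (mult_transpose (card I) M N)) (sub_col_ball \<sigma> I \<times> sub_col_ball \<sigma> I)
      (submat X I, submat Y I)"
    (is "local_min_on ?h ?S ?s \<longleftrightarrow> local_min_on ?k ?T ?t")
proof
  have s: "?s \<in> ?S" using assms by (simp add: keep_cols_in_supp_ball)
  have t: "?t \<in> ?T" using X Y by (simp add: sub_col_ball_def)
  have k: "?k (submat A I, submat B I) = ?h (A, B)" if "A \<in> supp_ball \<sigma> I" "B \<in> supp_ball \<sigma> I"
    for A :: "real^('d::{finite,linorder})^'m" and B :: "real^('d::{finite,linorder})^'n"
    using mult_transpose_submat_supp_ball[OF that] by simp
  have hs: "?k ?t = ?h ?s"
    using k[of "keep_cols I X" "keep_cols I Y"] s by (simp add: submat_keep_cols)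
  {
    define g where "g p = (fill_cols I (fst p) :: real^('d::{finite,linorder})^'m, fill_cols I (snd p) :: real^('d::{finite,linorder})^'n)" for p
    have gt: "g ?t = ?s" by (simp add: g_def fill_cols_submat)
    assume h: "local_min_on ?h ?S ?s"
    show "local_min_on ?k ?T ?t"
    proof (rule local_min_on_pullback[OF h t])
      have "continuous_on ?T g"
        unfolding g_def
        by (intro continuous_on_Pair continuous_on_compose2[OF continuous_on_fill_cols[of UNIV]]
              continuous_on_fst continuous_on_snd continuous_on_id) auto
      then show "(g \<longlongrightarrow> ?s) (at ?t within ?T)"
        using t gt by (metis continuous_on_def)
      show "g p \<in> ?S" if "p \<in> ?T" for p
        using that assms(1) by (auto simp: g_def intro: sub_col_ball_cases(1))
      have "?h (g p) = ?k p" if p: "p \<in> ?T" for p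
      proof -
        obtain M N where "p = (M, N)" "M \<in> sub_col_ball \<sigma> I" "N \<in> sub_col_ball \<sigma> I"
          using p by auto
        then show ?thesis
          using k[of "fill_cols I M" "fill_cols I N"] assms(1)
          by (simp add: g_def sub_col_ball_cases[where \<sigma> = \<sigma>])
      qed
      then show "\<forall>\<^sub>F p in at ?t within ?T. ?h (g p) + ?k ?t \<le> ?k p + ?h ?s"
        unfolding eventually_at_filter hs by (intro always_eventually) simp
    qed
  next
    define g where "g p = (submat (fst p) I, submat (snd p) I)" for p :: "(real^('d::{finite,linorder})^'m) \<times> (real^('d::{finite,linorder})^'n)"
    have gs: "g ?s = ?t" by (simp add: g_def submat_keep_cols)
    assume h: "local_min_on ?k ?T ?t"
    show "local_min_on ?h ?S ?s"
    proof (rule local_min_on_pullback[OF h s])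
      have "continuous_on ?S g"
        unfolding g_def
        by (intro continuous_on_Pair continuous_on_compose2[OF continuous_on_submat[of UNIV]]
              continuous_on_fst continuous_on_snd continuous_on_id) auto
      then show "(g \<longlongrightarrow> ?t) (at ?s within ?S)"
        using s gs by (metis continuous_on_def)
      show "g p \<in> ?T" if "p \<in> ?S" for p
        using that by (auto simp: g_def submat_in_sub_col_ball)
      have "?k (g p) = ?h p" if "p \<in> ?S" for p
        using that k[of "fst p" "snd p"] by (auto simp: g_def)
      then show "\<forall>\<^sub>F p in at ?s within ?S. ?k (g p) + ?h ?s \<le> ?h p + ?k ?t"
        unfolding eventually_at_filter hs by (intro always_eventually) simp
    qed
  }
qed

lemma local_minimizer_iff_submat:
  fixes X :: "real^('d::{finite,linorder})^'m" and Y :: "real^('d::{finite,linorder})^'n"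
  assumes "locally_Lipschitz f" and "lam > 0" "\<sigma> \<ge> 0"
    and "(X, Y) \<in> col_ball \<sigma> \<times> col_ball \<sigma>"
  shows "(X, Y) \<in> local_minimizers f lam \<sigma> \<longleftrightarrow>
    local_min_on (\<lambda>(M, N). f (mult_transpose (card (common_cols X Y)) M N))
      (sub_feasible \<sigma> X Y) (submat X (common_cols X Y), submat Y (common_cols X Y))"
  using local_minimizer_iff_supported[OF assms] assms(3,4)
  by (simp add: supported_local_min_iff_submat sub_feasible_def)

text \<open>
  The map \<open>(X', Y') \<mapsto> X' ** transpose Y'\<close> is continuous, so local minimality of the product passes to
  the factors.
\<close>
lemma local_minimizer_if_product_local_min:
  fixes X :: "real^('d::{finite,linorder})^'m" and Y :: "real^('d::{finite,linorder})^'n"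
  assumes "locally_Lipschitz f" and "lam > 0" "\<sigma> \<ge> 0"
    and XY: "(X, Y) \<in> col_ball \<sigma> \<times> col_ball \<sigma>"
    and loc: "local_min_on f
       {mult_transpose (card (common_cols X Y)) M N | M N. (M, N) \<in> sub_feasible \<sigma> X Y} (X ** transpose Y)"
  shows "(X, Y) \<in> local_minimizers f lam \<sigma>"
proof -
  let ?I = "common_cols X Y"
  let ?S = "supp_ball \<sigma> ?I \<times> supp_ball \<sigma> ?I" and ?s = "(keep_cols ?I X, keep_cols ?I Y)"
  have s: "?s \<in> ?S" using XY assms(3) by (simp add: keep_cols_in_supp_ball)
  have prod: "keep_cols ?I X ** transpose (keep_cols ?I Y) = X ** transpose Y"
    by (simp add: mult_transpose_keep_common_cols)
  have lim_fst: "(fst \<longlongrightarrow> keep_cols ?I X) (at ?s within ?S)"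
    and lim_snd: "(snd \<longlongrightarrow> keep_cols ?I Y) (at ?s within ?S)"
    using tendsto_fst[OF tendsto_ident_at[of ?s ?S]] tendsto_snd[OF tendsto_ident_at[of ?s ?S]] by simp_all
  have "local_min_on (\<lambda>(X', Y'). f (X' ** transpose Y')) ?S ?s"
  proof (rule local_min_on_pullback[OF loc s])
    show "((\<lambda>p. fst p ** transpose (snd p)) \<longlongrightarrow> X ** transpose Y) (at ?s within ?S)"
      unfolding prod[symmetric] by (intro tendsto_mult_transpose lim_fst lim_snd)
    show "fst p ** transpose (snd p) \<in> 
        {mult_transpose (card ?I) M N | M N. (M, N) \<in> sub_feasible \<sigma> X Y}" if p: "p \<in> ?S" for p
    proof -
      have "fst p \<in> supp_ball \<sigma> ?I" "snd p \<in> supp_ball \<sigma> ?I" using p by auto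
      then show ?thesis
        unfolding sub_feasible_def mem_Collect_eq
        by (intro exI[of _ "submat (fst p) ?I"] exI[of _ "submat (snd p) ?I"])
          (simp add: mult_transpose_submat_supp_ball submat_in_sub_col_ball)
    qed
    show "\<forall>\<^sub>F p in at ?s within ?S. f (fst p ** transpose (snd p)) + (case ?s of (X', Y') \<Rightarrow> f (X' ** transpose Y'))
        \<le> (case p of (X', Y') \<Rightarrow> f (X' ** transpose Y')) + f (X ** transpose Y)"
      by (intro always_eventually) (auto simp: prod)
  qed
  then show ?thesis
    using local_minimizer_iff_supported[OF assms(1-4)] by simp
qed

section \<open>Stationarity of local minimizers\<close>

lemma supp_ball_eq_Inter:
  assumes "0 \<le> \<sigma>"
  shows "supp_ball \<sigma> I = (\<Inter>i. column i -` (if i \<in> I then cball 0 \<sigma> else {0}))"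
  using assms by (fastforce simp: supp_ball_def col_ball_def nz_cols_def split: if_splits)

lemma closed_supp_ball: "0 \<le> \<sigma> \<Longrightarrow> closed (supp_ball \<sigma> I)"
  unfolding supp_ball_eq_Inter
  by (intro closed_INT ballI closed_vimage) (auto intro: continuous_on_column continuous_on_id)

lemma convex_supp_ball: "0 \<le> \<sigma> \<Longrightarrow> convex (supp_ball \<sigma> I)"
  unfolding supp_ball_eq_Inter
  by (intro convex_INT convex_linear_vimage bounded_linear.linear[OF bounded_linear_column]) auto

text \<open>
  The two forms of the Frobenius product with \<open>U ** transpose V\<close> express the partial gradients
  \<open>H V\<close> and \<open>transpose H U\<close> column by column.
\<close>
lemma inner_mult_transpose:
  fixes H :: "real^'n^'m" and U :: "real^'d^'m" and V :: "real^'d^'n"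
  shows "inner H (U ** transpose V) = (\<Sum>l\<in>UNIV. inner (H *v column l V) (column l U))"
proof -
  have "inner H (U ** transpose V) = (\<Sum>i\<in>UNIV. \<Sum>j\<in>UNIV. \<Sum>l\<in>UNIV. H $ i $ j * (U $ i $ l * V $ j $ l))"
    by (simp add: inner_vec_def matrix_matrix_mult_def transpose_def sum_distrib_left)
  also have "\<dots> = (\<Sum>i\<in>UNIV. \<Sum>l\<in>UNIV. \<Sum>j\<in>UNIV. H $ i $ j * (U $ i $ l * V $ j $ l))"
    by (intro sum.cong refl sum.swap)
  also have "\<dots> = (\<Sum>l\<in>UNIV. \<Sum>i\<in>UNIV. \<Sum>j\<in>UNIV. H $ i $ j * (U $ i $ l * V $ j $ l))"
    by (rule sum.swap)
  also have "\<dots> = (\<Sum>l\<in>UNIV. inner (H *v column l V) (column l U))"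
    by (simp add: inner_vec_def matrix_vector_mult_def column_def sum_distrib_right sum_distrib_left mult_ac)
  finally show ?thesis .
qed

lemma inner_transpose_mult_transpose:
  fixes H :: "real^'n^'m" and U :: "real^'d^'m" and V :: "real^'d^'n"
  shows "inner H (U ** transpose V) = (\<Sum>l\<in>UNIV. inner (transpose H *v column l U) (column l V))"
  unfolding inner_mult_transpose
  by (intro sum.cong refl) (simp add: inner_commute dot_lmul_matrix[symmetric] transpose_matrix_vector)

text \<open>
  Carries a variational inequality for full matrices over to the normal cone in the space of
  submatrices. Here \<open>v i\<close> plays the role of the partial gradient in column \<open>i\<close>.
\<close>
lemma normal_cone_sub_col_ballI:
  fixes X :: "real^('d::{finite,linorder})^'r" and v :: "'d \<Rightarrow> real^'r"
  assumes "0 \<le> \<sigma>" and X: "X \<in> col_ball \<sigma>"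
    and v: "\<And>W. W \<in> supp_ball \<sigma> I \<Longrightarrow> 0 \<le> (\<Sum>i\<in>I. inner (v i) (column i (W - X)))"
  shows "(\<lambda>l\<in>{..<card I}. - v (sorted_list_of_set I ! l)) \<in>
    normal_cone (card I) (sub_col_ball \<sigma> I) (submat X I)"
proof -
  have "(\<Sum>l<card I. inner ((\<lambda>l\<in>{..<card I}. - v (sorted_list_of_set I ! l)) l) (submat Z I l - submat X I l)) \<le> 0"
    if Z: "Z \<in> col_ball \<sigma>" for Z :: "real^('d::{finite,linorder})^'r"
  proof -
    have "(\<Sum>l<card I. inner ((\<lambda>l\<in>{..<card I}. - v (sorted_list_of_set I ! l)) l) (submat Z I l - submat X I l))
       = (\<Sum>l<card I. - inner (v (sorted_list_of_set I ! l)) (column (sorted_list_of_set I ! l) (Z - X)))"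
      by (intro sum.cong) (simp_all add: submat_nth column_diff)
    also have "\<dots> = (\<Sum>i\<in>I. - inner (v i) (column i (Z - X)))"
      by (rule sum_sorted_list_of_set)
    also have "\<dots> = - (\<Sum>i\<in>I. inner (v i) (column i (keep_cols I Z - X)))"
      by (simp add: sum_negf column_diff column_keep_cols)
    also have "\<dots> \<le> 0"
      using v[OF keep_cols_in_supp_ball[OF assms(1) Z]] by simp
    finally show ?thesis .
  qed
  then show ?thesis
    using X by (auto simp: normal_cone_def col_matrices_def sub_col_ball_def)
qed

text \<open>
  The multiplier rule is applied to \<open>(X', Y') \<mapsto> X' ** transpose Y'\<close> on the product of the two convex
  sets \<open>supp_ball \<sigma> I\<close>. Varying one factor at a time separates its conclusion into the two
  stationarity conditions, with one and the same \<open>H\<close>.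
\<close>
lemma local_minimizer_is_stationary:
  fixes X :: "real^('d::{finite,linorder})^'m" and Y :: "real^('d::{finite,linorder})^'n"
  assumes lip: "locally_Lipschitz f" and "lam > 0" and \<sigma>: "\<sigma> \<ge> 0"
    and loc: "(X, Y) \<in> local_minimizers f lam \<sigma>"
  shows "(X, Y) \<in> stationary_points f \<sigma>"
proof -
  define I where "I = common_cols X Y"
  let ?S = "supp_ball \<sigma> I \<times> supp_ball \<sigma> I :: ((real^('d::{finite,linorder})^'m) \<times> (real^('d::{finite,linorder})^'n)) set"
  let ?Xs = "keep_cols I X" and ?Ys = "keep_cols I Y"
  have XY: "X \<in> col_ball \<sigma>" "Y \<in> col_ball \<sigma>"
    using loc by (auto simp: local_minimizers_def local_min_on_def)
  have prod: "?Xs ** transpose ?Ys = X ** transpose Y"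
    by (simp add: I_def mult_transpose_keep_common_cols)
  define \<Phi> where "\<Phi> p = fst p ** transpose (snd p)" for p :: "(real^('d::{finite,linorder})^'m) \<times> (real^('d::{finite,linorder})^'n)"
  define D where "D p v = fst p ** transpose (snd v) + fst v ** transpose (snd p)"
    for p v :: "(real^('d::{finite,linorder})^'m) \<times> (real^('d::{finite,linorder})^'n)"
  have restricted: "local_min_on (\<lambda>p. f (\<Phi> p)) ?S (?Xs, ?Ys)"
    using local_minimizer_iff_supported[OF lip \<open>lam > 0\<close> \<sigma>, of X Y] XY loc
    by (simp add: \<Phi>_def I_def case_prod_beta')
  have deriv: "(\<Phi> has_derivative D p) (at p)" for p
    unfolding \<Phi>_def D_def
    by (rule bounded_bilinear.FDERIV[OF bounded_bilinear_mult_transpose])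
      (auto intro: derivative_intros)
  have D_cont: "isCont (\<lambda>p. D (fst p) (snd p)) q" for q
    unfolding D_def isCont_def by (intro tendsto_intros tendsto_mult_transpose)
  have S_closed: "closed ?S" and S_convex: "convex ?S"
    using \<sigma> by (simp_all add: closed_Times convex_Times closed_supp_ball convex_supp_ball)
  obtain H where H: "H \<in> limiting_subdifferential f (\<Phi> (?Xs, ?Ys))"
    "\<And>w. w \<in> ?S \<Longrightarrow> 0 \<le> inner H (D (?Xs, ?Ys) (w - (?Xs, ?Ys)))"
    using multiplier_of_local_min_composition[OF lip S_closed S_convex deriv D_cont restricted] by blast
  have S: "?Xs \<in> supp_ball \<sigma> I" "?Ys \<in> supp_ball \<sigma> I"
    using XY \<sigma> by (simp_all add: keep_cols_in_supp_ball)
  have sum_I: "(\<Sum>l\<in>UNIV. g l) = (\<Sum>i\<in>I. g i)" if "\<And>l. l \<notin> I \<Longrightarrow> g l = 0" for g :: "'d \<Rightarrow> real"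
    using that by (intro sum.mono_neutral_right) auto
  note mult_zero = bounded_bilinear.zero_left[OF bounded_bilinear_mult_transpose]
    bounded_bilinear.zero_right[OF bounded_bilinear_mult_transpose]
  have "0 \<le> (\<Sum>i\<in>I. inner (H *v column i Y) (column i (W - X)))" if "W \<in> supp_ball \<sigma> I" for W
  proof -
    have "0 \<le> inner H ((W - ?Xs) ** transpose ?Ys)"
      using H(2)[of "(W, ?Ys)"] that S by (simp add: D_def mult_zero)
    also have "\<dots> = (\<Sum>l\<in>I. inner (H *v column l ?Ys) (column l (W - ?Xs)))"
      unfolding inner_mult_transpose by (intro sum_I) (simp add: column_keep_cols)
    finally show ?thesis by (simp add: column_keep_cols column_diff)
  qed
  from normal_cone_sub_col_ballI[OF \<sigma> XY(1) this]
  have V: "(\<lambda>l\<in>{..<card I}. - (H *v column (sorted_list_of_set I ! l) Y)) \<in>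
      normal_cone (card I) (sub_col_ball \<sigma> I) (submat X I)" .
  have "0 \<le> (\<Sum>i\<in>I. inner (transpose H *v column i X) (column i (W - Y)))" if "W \<in> supp_ball \<sigma> I" for W
  proof -
    have "0 \<le> inner H (?Xs ** transpose (W - ?Ys))"
      using H(2)[of "(?Xs, W)"] that S by (simp add: D_def mult_zero)
    also have "\<dots> = (\<Sum>l\<in>I. inner (transpose H *v column l ?Xs) (column l (W - ?Ys)))"
      unfolding inner_transpose_mult_transpose by (intro sum_I) (simp add: column_keep_cols)
    finally show ?thesis by (simp add: column_keep_cols column_diff)
  qed
  from normal_cone_sub_col_ballI[OF \<sigma> XY(2) this]
  have W: "(\<lambda>l\<in>{..<card I}. - (transpose H *v column (sorted_list_of_set I ! l) X)) \<in>
      normal_cone (card I) (sub_col_ball \<sigma> I) (submat Y I)" .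
  have "H \<in> limiting_subdifferential f (X ** transpose Y)"
    using H(1) by (simp add: \<Phi>_def prod)
  moreover have "\<exists>V \<in> normal_cone (card I) (sub_col_ball \<sigma> I) (submat X I).
      \<forall>l<card I. 0 = H *v submat Y I l + V l"
    by (rule bexI[OF _ V]) (simp add: submat_nth)
  moreover have "\<exists>W \<in> normal_cone (card I) (sub_col_ball \<sigma> I) (submat Y I).
      \<forall>l<card I. 0 = transpose H *v submat X I l + W l"
    by (rule bexI[OF _ W]) (simp add: submat_nth)
  ultimately show ?thesis
    using XY unfolding stationary_points_def Let_def I_def by auto
qed

section \<open>Dropping the columns that are not common\<close>

lemma common_cols_keep_common_cols:
  "common_cols (keep_cols (common_cols X Y) X) (keep_cols (common_cols X Y) Y) = common_cols X Y"
  by (auto simp: common_cols_def)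

text \<open>
  The criterion \<open>local_minimizer_iff_submat\<close> sees only the common columns, and these do not change.
\<close>
lemma local_minimizer_keep_common_cols:
  fixes X :: "real^('d::{finite,linorder})^'m" and Y :: "real^('d::{finite,linorder})^'n"
  assumes "locally_Lipschitz f" and "lam > 0" "\<sigma> \<ge> 0"
    and "(X, Y) \<in> local_minimizers f lam \<sigma>"
  shows "(keep_cols (common_cols X Y) X, keep_cols (common_cols X Y) Y) \<in> local_minimizers f lam \<sigma>"
proof -
  have XY: "(X, Y) \<in> col_ball \<sigma> \<times> col_ball \<sigma>"
    using assms(4) by (auto simp: local_minimizers_def local_min_on_def)
  then have "(keep_cols (common_cols X Y) X, keep_cols (common_cols X Y) Y) \<in> col_ball \<sigma> \<times> col_ball \<sigma>"
    using assms(3) by (simp add: keep_cols_in_col_ball)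
  from local_minimizer_iff_submat[OF assms(1-3) this] local_minimizer_iff_submat[OF assms(1-3) XY] assms(4)
  show ?thesis
    by (simp add: common_cols_keep_common_cols submat_keep_cols sub_feasible_def)
qed

lemma stationary_keep_common_cols:
  fixes X :: "real^('d::{finite,linorder})^'m" and Y :: "real^('d::{finite,linorder})^'n"
  assumes "\<sigma> \<ge> 0" "(X, Y) \<in> stationary_points f \<sigma>"
  shows "(keep_cols (common_cols X Y) X, keep_cols (common_cols X Y) Y) \<in> stationary_points f \<sigma>"
  using assms
  by (simp add: stationary_points_def common_cols_keep_common_cols submat_keep_cols
      mult_transpose_keep_common_cols keep_cols_in_col_ball)

section \<open>Rescaling the factors\<close>

definition scale_cols :: "('d \<Rightarrow> real) \<Rightarrow> real^'d^'r \<Rightarrow> real^'d^'r" where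
  "scale_cols s C = (\<chi> i j. s j * C $ i $ j)"

lemma column_scale_cols: "column l (scale_cols s C) = s l *\<^sub>R column l C"
  by (simp add: scale_cols_def column_def vec_eq_iff)

lemma F0_scale_cols:
  fixes X :: "real^'d^'m" and Y :: "real^'d^'n"
  assumes st: "\<And>l. s l * t l = 1"
  shows "F0 f lam (scale_cols s X) (scale_cols t Y) = F0 f lam X Y"
proof -
  have entry: "s l * X $ i $ l * (t l * Y $ j $ l) = X $ i $ l * Y $ j $ l" for i j l
    using arg_cong[OF st[of l], of "\<lambda>c. c * (X $ i $ l * Y $ j $ l)"] by (simp add: mult_ac)
  have "scale_cols s X ** transpose (scale_cols t Y) = X ** transpose Y"
    by (simp add: scale_cols_def matrix_matrix_mult_def transpose_def vec_eq_iff entry)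
  moreover have "s l \<noteq> 0" "t l \<noteq> 0" for l
    using st[of l] by auto
  then have "nz_cols (scale_cols s X) = nz_cols X" "nz_cols (scale_cols t Y) = nz_cols Y"
    by (simp_all add: nz_cols_def column_scale_cols)
  ultimately show ?thesis by (simp add: F0_def nnzc_def)
qed

lemma F0_rescale:
  fixes X :: "real^'d^'m" and Y :: "real^'d^'n"
  assumes "\<gamma> \<noteq> 0"
  shows "F0 f lam (\<gamma> *\<^sub>R X) ((1 / \<gamma>) *\<^sub>R Y) = F0 f lam X Y"
proof -
  have "\<gamma> *\<^sub>R X = scale_cols (\<lambda>_. \<gamma>) X" "(1 / \<gamma>) *\<^sub>R Y = scale_cols (\<lambda>_. 1 / \<gamma>) Y"
    by (simp_all add: scale_cols_def vec_eq_iff)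
  then show ?thesis
    using F0_scale_cols[of "\<lambda>_. \<gamma>" "\<lambda>_. 1 / \<gamma>" f lam X Y] assms by simp
qed

text \<open>
  The obstacle is feasibility: undoing the scaling multiplies \<open>Y'\<close> by \<open>\<gamma>\<close> and may push a column out of
  the ball of radius \<open>\<sigma>\<close>. The product depends on each pair of columns only up to reciprocal
  factors, so such a column is shrunk back by a factor \<open>c\<close>, and the column of the other factor is
  enlarged by \<open>1 / c\<close>. There is room for this because that column has just been divided by \<open>\<gamma>\<close> with
  \<open>\<bar>\<gamma>\<bar> \<ge> 1\<close>. At the scaled point itself \<open>c = 1\<close>, so the correction is continuous and harmless.
\<close>
lemma local_minimizer_rescale_ge_1:
  fixes X :: "real^'d^'m" and Y :: "real^'d^'n"
  assumes \<sigma>: "\<sigma> > 0" and \<gamma>: "\<bar>\<gamma>\<bar> \<ge> 1"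
    and loc: "(X, Y) \<in> local_minimizers f lam \<sigma>"
    and feas: "(\<gamma> *\<^sub>R X, (1 / \<gamma>) *\<^sub>R Y) \<in> col_ball \<sigma> \<times> col_ball \<sigma>"
  shows "(\<gamma> *\<^sub>R X, (1 / \<gamma>) *\<^sub>R Y) \<in> local_minimizers f lam \<sigma>"
proof -
  let ?B = "col_ball \<sigma> \<times> col_ball \<sigma> :: ((real^'d^'m) \<times> (real^'d^'n)) set"
  let ?y = "(\<gamma> *\<^sub>R X, (1 / \<gamma>) *\<^sub>R Y)" and ?F = "\<lambda>(X, Y). F0 f lam X Y"
  have \<gamma>0: "\<gamma> \<noteq> 0" using \<gamma> by auto
  define c where "c B l = \<sigma> / max \<sigma> (\<bar>\<gamma>\<bar> * norm (column l B))" for B :: "real^'d^'n" and l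
  define g where "g p = (scale_cols (\<lambda>l. 1 / (\<gamma> * c (snd p) l)) (fst p),
      scale_cols (\<lambda>l. \<gamma> * c (snd p) l) (snd p))" for p :: "(real^'d^'m) \<times> (real^'d^'n)"
  have c_pos: "c B l > 0" for B l
    using \<sigma> by (simp add: c_def less_max_iff_disj)
  have Y: "norm (column l Y) \<le> \<sigma>" for l
    using loc by (auto simp: local_minimizers_def local_min_on_def col_ball_def)
  have c_y: "c ((1 / \<gamma>) *\<^sub>R Y) l = 1" for l
    using \<gamma>0 \<sigma> Y[of l] by (simp add: c_def column_scaleR max_def)
  have g_y: "g ?y = (X, Y)"
    using \<gamma>0 by (simp add: g_def c_y scale_cols_def vec_eq_iff)
  have F_g: "?F (g p) = ?F p" for p
    using F0_scale_cols[of "\<lambda>l. 1 / (\<gamma> * c (snd p) l)" "\<lambda>l. \<gamma> * c (snd p) l" f lam "fst p" "snd p"]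
      c_pos[of "snd p"] \<gamma>0 by (simp add: g_def case_prod_beta less_imp_neq[THEN not_sym])
  show ?thesis
    unfolding local_minimizers_def mem_Collect_eq
  proof (rule local_min_on_pullback[OF loc[unfolded local_minimizers_def mem_Collect_eq] feas])
    have lim_fst: "(fst \<longlongrightarrow> fst ?y) (at ?y within ?B)"
      and lim_snd: "(snd \<longlongrightarrow> snd ?y) (at ?y within ?B)"
      by (rule tendsto_fst[OF tendsto_ident_at], rule tendsto_snd[OF tendsto_ident_at])
    have lim_c: "((\<lambda>p. c (snd p) l) \<longlongrightarrow> c (snd ?y) l) (at ?y within ?B)" for l
      unfolding c_def using \<sigma> by (intro tendsto_intros tendsto_max lim_snd) auto
    have "(g \<longlongrightarrow> g ?y) (at ?y within ?B)"
      unfolding g_def scale_cols_def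
      using c_pos[of "snd ?y"] \<gamma>0
      by (intro tendsto_Pair tendsto_vec_lambda tendsto_mult tendsto_divide tendsto_vec_nth tendsto_const
            lim_fst lim_snd lim_c) (auto simp: less_imp_neq[THEN not_sym])
    then show "(g \<longlongrightarrow> (X, Y)) (at ?y within ?B)" by (simp only: g_y)
    show "g p \<in> ?B" if p: "p \<in> ?B" for p
    proof -
      have A: "norm (column l (fst p)) \<le> \<sigma>" and B: "norm (column l (snd p)) \<le> \<sigma>" for l
        using p by (auto simp: col_ball_def)
      have le: "max \<sigma> (\<bar>\<gamma>\<bar> * norm (column l (snd p))) \<le> \<bar>\<gamma>\<bar> * \<sigma>" for l
        using \<gamma> \<sigma> mult_left_mono[OF B[of l], of "\<bar>\<gamma>\<bar>"] by simp
      \<comment> \<open>The enlargement by \<open>1 / c\<close> never exceeds what the division by \<open>\<gamma>\<close> has gained.\<close>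
      have ge1: "1 \<le> \<bar>\<gamma>\<bar> * c (snd p) l" for l
        using le[of l] \<sigma> by (simp add: c_def less_max_iff_disj pos_le_divide_eq)
      have "norm (column l (scale_cols (\<lambda>l. 1 / (\<gamma> * c (snd p) l)) (fst p))) \<le> \<sigma>" for l
      proof -
        have "norm (column l (fst p)) / (\<bar>\<gamma>\<bar> * c (snd p) l) \<le> \<sigma> / 1"
          using ge1[of l] A[of l] \<sigma> by (intro frac_le) auto
        then show ?thesis
          using c_pos[of "snd p" l] by (simp add: column_scale_cols abs_mult)
      qed
      moreover have "norm (column l (scale_cols (\<lambda>l. \<gamma> * c (snd p) l) (snd p))) \<le> \<sigma>" for l
      proof -
        have "\<sigma> * (\<bar>\<gamma>\<bar> * norm (column l (snd p))) \<le> \<sigma> * max \<sigma> (\<bar>\<gamma>\<bar> * norm (column l (snd p)))"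
          using \<sigma> by simp
        then have "\<bar>\<gamma>\<bar> * c (snd p) l * norm (column l (snd p)) \<le> \<sigma>"
          using \<sigma> by (simp add: c_def less_max_iff_disj pos_divide_le_eq mult_ac)
        then show ?thesis
          using c_pos[of "snd p" l] by (simp add: column_scale_cols abs_mult)
      qed
      ultimately show ?thesis by (simp add: g_def col_ball_def)
    qed
    show "\<forall>\<^sub>F p in at ?y within ?B. ?F (g p) + ?F ?y \<le> ?F p + ?F (X, Y)"
      unfolding F_g using F0_rescale[OF \<gamma>0, of f lam X Y] by (intro always_eventually) simp
  qed
qed

text \<open>
  The problem is symmetric under exchange of the factors, which reduces the case \<open>\<bar>\<gamma>\<bar> < 1\<close> to the
  previous lemma.
\<close>
lemma local_minimizer_swap:
  fixes X :: "real^'d^'m" and Y :: "real^'d^'n"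
  assumes loc: "(X, Y) \<in> local_minimizers f lam \<sigma>"
  shows "(Y, X) \<in> local_minimizers (\<lambda>Z. f (transpose Z)) lam \<sigma>"
  unfolding local_minimizers_def mem_Collect_eq
proof (rule local_min_on_pullback[OF loc[unfolded local_minimizers_def mem_Collect_eq]])
  let ?B = "col_ball \<sigma> \<times> col_ball \<sigma> :: ((real^'d^'n) \<times> (real^'d^'m)) set"
  show "(Y, X) \<in> ?B"
    using loc by (auto simp: local_minimizers_def local_min_on_def)
  have "((\<lambda>p. (snd p, fst p)) \<longlongrightarrow> (snd (Y, X), fst (Y, X))) (at (Y, X) within ?B)"
    by (intro tendsto_intros)
  then show "((\<lambda>p. (snd p, fst p)) \<longlongrightarrow> (X, Y)) (at (Y, X) within ?B)" by simp
  have "F0 f lam A B = F0 (\<lambda>Z. f (transpose Z)) lam B A" for A :: "real^'d^'m" and B :: "real^'d^'n"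
    by (simp add: F0_def matrix_transpose_mul)
  then show "\<forall>\<^sub>F p in at (Y, X) within ?B.
      (case (snd p, fst p) of (X, Y) \<Rightarrow> F0 f lam X Y) + (case (Y, X) of (X, Y) \<Rightarrow> F0 (\<lambda>Z. f (transpose Z)) lam X Y)
      \<le> (case p of (X, Y) \<Rightarrow> F0 (\<lambda>Z. f (transpose Z)) lam X Y) + (case (X, Y) of (X, Y) \<Rightarrow> F0 f lam X Y)"
    by (intro always_eventually) auto
qed auto

lemma local_minimizer_rescale:
  fixes X :: "real^'d^'m" and Y :: "real^'d^'n"
  assumes \<sigma>: "\<sigma> > 0" and \<gamma>: "\<gamma> \<noteq> 0"
    and loc: "(X, Y) \<in> local_minimizers f lam \<sigma>"
    and feas: "(\<gamma> *\<^sub>R X, (1 / \<gamma>) *\<^sub>R Y) \<in> col_ball \<sigma> \<times> col_ball \<sigma>"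
  shows "(\<gamma> *\<^sub>R X, (1 / \<gamma>) *\<^sub>R Y) \<in> local_minimizers f lam \<sigma>"
proof (cases "\<bar>\<gamma>\<bar> \<ge> 1")
  case True
  then show ?thesis using local_minimizer_rescale_ge_1[OF \<sigma>] loc feas by blast
next
  case False
  then have "\<bar>1 / \<gamma>\<bar> \<ge> 1" using \<gamma> by simp
  from local_minimizer_rescale_ge_1[OF \<sigma> this local_minimizer_swap[OF loc]] feas
  have "((1 / \<gamma>) *\<^sub>R Y, \<gamma> *\<^sub>R X) \<in> local_minimizers (\<lambda>Z. f (transpose Z)) lam \<sigma>" by simp
  from local_minimizer_swap[OF this] show ?thesis by simp
qed

theorem proposition6:
  fixes f :: "real^'n^'m \<Rightarrow> real"
    and lam \<sigma> :: real
    and X :: "real^('d::{finite,linorder})^'m"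
    and Y :: "real^('d::{finite,linorder})^'n"
  assumes "CARD('n) \<le> CARD('m)"
    and "lam > 0"
    and "\<sigma> > 0"
    and "locally_Lipschitz f"
  shows
    "((X, Y) \<in> global_minimizers f lam \<sigma> \<longrightarrow> nz_cols X = nz_cols Y)
    \<and>
    ((X, Y) \<in> col_ball \<sigma> \<times> col_ball \<sigma> \<longrightarrow>
       ((X, Y) \<in> local_minimizers f lam \<sigma> \<longleftrightarrow>
          local_min_on (\<lambda>(M, N). f (mult_transpose (card (common_cols X Y)) M N))
            (sub_feasible \<sigma> X Y)
            (submat X (common_cols X Y), submat Y (common_cols X Y))) \<and>
       (local_min_on f
          {mult_transpose (card (common_cols X Y)) M N | M N. (M, N) \<in> sub_feasible \<sigma> X Y}
          (X ** transpose Y) \<longrightarrow>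
        (X, Y) \<in> local_minimizers f lam \<sigma>))
    \<and>
    ((local_minimizers f lam \<sigma> :: ((real^('d::{finite,linorder})^'m) \<times> (real^('d::{finite,linorder})^'n)) set)
       \<subseteq> stationary_points f \<sigma>) \<and>
    (let Xs = keep_cols (common_cols X Y) X; Ys = keep_cols (common_cols X Y) Y in
       ((X, Y) \<in> local_minimizers f lam \<sigma> \<longrightarrow>
          (Xs, Ys) \<in> local_minimizers f lam \<sigma> \<and> F0 f lam Xs Ys \<le> F0 f lam X Y) \<and>
       ((X, Y) \<in> stationary_points f \<sigma> \<longrightarrow>
          (Xs, Ys) \<in> stationary_points f \<sigma> \<and> F0 f lam Xs Ys \<le> F0 f lam X Y))
    \<and>
    (\<forall>\<gamma>::real. \<gamma> \<noteq> 0 \<longrightarrow> (\<gamma> *\<^sub>R X, (1 / \<gamma>) *\<^sub>R Y) \<in> col_ball \<sigma> \<times> col_ball \<sigma> \<longrightarrow>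
       ((X, Y) \<in> global_minimizers f lam \<sigma> \<longrightarrow>
          (\<gamma> *\<^sub>R X, (1 / \<gamma>) *\<^sub>R Y) \<in> global_minimizers f lam \<sigma>) \<and>
       ((X, Y) \<in> local_minimizers f lam \<sigma> \<longrightarrow>
          (\<gamma> *\<^sub>R X, (1 / \<gamma>) *\<^sub>R Y) \<in> local_minimizers f lam \<sigma>))"
proof -
  have \<sigma>: "\<sigma> \<ge> 0" and lam: "0 \<le> lam" using assms by simp_all
  note lip = assms(4) and lam_pos = assms(2)
  have drop_le: "F0 f lam (keep_cols (common_cols X Y) X) (keep_cols (common_cols X Y) Y) \<le> F0 f lam X Y"
    by (rule F0_keep_common_cols_le[OF lam])
  have stationary: "(local_minimizers f lam \<sigma> :: ((real^('d::{finite,linorder})^'m) \<times> (real^('d::{finite,linorder})^'n)) set)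
      \<subseteq> stationary_points f \<sigma>"
    using local_minimizer_is_stationary[OF lip lam_pos \<sigma>] by (intro subrelI)
  have global_rescale: "(\<gamma> *\<^sub>R X, (1 / \<gamma>) *\<^sub>R Y) \<in> global_minimizers f lam \<sigma>"
    if "(X, Y) \<in> global_minimizers f lam \<sigma>" "\<gamma> \<noteq> 0"
      "(\<gamma> *\<^sub>R X, (1 / \<gamma>) *\<^sub>R Y) \<in> col_ball \<sigma> \<times> col_ball \<sigma>" for \<gamma>
    using that unfolding global_minimizers_iff F0_rescale[OF that(2)] by blast
  show ?thesis
    unfolding Let_def
    by (intro conjI allI impI;
        (rule stationary drop_le global_rescale
          global_minimizer_column_consistent[OF _ lam_pos \<sigma>]
          local_minimizer_iff_submat[OF lip lam_pos \<sigma>]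
          local_minimizer_keep_common_cols[OF lip lam_pos \<sigma>]
          stationary_keep_common_cols[OF \<sigma>]
          local_minimizer_rescale[OF assms(3)]
          local_minimizer_if_product_local_min[OF lip lam_pos \<sigma>]; assumption))
qed

end
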